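(* Let $d\ge 1$ and consider the deep neural network (DNN) dynamics with the hyperbolic tangent function $\phi=\tanh$. For every real number $C$ there exist DNN parameters, i.e. a sequence of matrices $\mathbf{W}_t\in\mathbb{R}^{d\times d}$ and vectors $\mathbf{b}_t\in\mathbb{R}^d$ ($t=1,2,\dots$), and an input $\mathbf{x}_0\in[-1,1]^d$, such that the maximum Lyapunov exponent of the corresponding random dynamics satisfies $\lambda_1(\mathbf{x}_0)>C$.
   Context: The DNN dynamics with parameters $(\mathbf{W}_t,\mathbf{b}_t)_{t\ge 1}$ is the sequence of maps $T_t:\mathbb{R}^d\to\mathbb{R}^d$, $T_t(\mathbf{x})=\phi(\mathbf{W}_t\mathbf{x}+\mathbf{b}_t)$, where $\phi$ is applied elementwise; the system state is $\mathbf{x}_t=T_t(\mathbf{x}_{t-1})$ with initial value $\mathbf{x}_0$. (A "random dynamical system" here is just a sequence of possibly distinct maps $T_1,T_2,\dots$.) Lyapunov exponents: let $\mathbf{J}_t(\mathbf{x}_0)$ be the Jacobian matrix of $T_t\circ T_{t-1}\circ\cdots\circ T_1$ at $\mathbf{x}_0$, and let $$\mathbf{L}(\mathbf{x}_0)=\lim_{t\to\infty}\left(\mathbf{J}_t(\mathbf{x}_0)\mathbf{J}_t(\mathbf{x}_0)^T\right)^{1/t}$$ (when the limit exists). The $i$-th largest Lyapunov exponent is $\lambda_i(\mathbf{x}_0)=\log_2\Lambda_i(\mathbf{x}_0)$, where $\Lambda_i(\mathbf{x}_0)$ is the $i$-th largest eigenvalue of $\mathbf{L}(\mathbf{x}_0)$;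 $\lambda_1$ is the maximum Lyapunov exponent. *)

theory Defs
  imports "HOL-Analysis.Analysis" "HOL-Library.Multiset"
begin

text \<open>The type of matrices carries no power operation for the matrix product.\<close>

definition matpow :: "real^'n^'n \<Rightarrow> nat \<Rightarrow> real^'n^'n" where
  "matpow A k = (((**) A) ^^ k) (mat 1)"

definition psd :: "real^'n^'n \<Rightarrow> bool" where
  "psd A \<longleftrightarrow> transpose A = A \<and> (\<forall>x. 0 \<le> x \<bullet> (A *v x))"

text \<open>For positive semidefinite \<open>A\<close> and \<open>t \<ge> 1\<close> this is the principal root \<open>A\<^bsup>1/t\<^esup>\<close>, which exists
  and is unique. The value for \<open>t = 0\<close> is meaningless and plays no role below.\<close>

definition psd_root :: "nat \<Rightarrow> real^'n^'n \<Rightarrow> real^'n^'n" where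
  "psd_root t A = (THE B. psd B \<and> matpow B t = A)"

definition eigenvalues :: "real^'n^'n \<Rightarrow> real set" where
  "eigenvalues A = {e. \<exists>v. v \<noteq> 0 \<and> A *v v = e *\<^sub>R v}"

text \<open>Geometric multiplicities; for the symmetric matrices considered here they agree with
  the algebraic ones.\<close>

definition eigenvalue_mset :: "real^'n^'n \<Rightarrow> real multiset" where
  "eigenvalue_mset A = (\<Sum>e\<in>eigenvalues A. replicate_mset (dim {v. A *v v = e *\<^sub>R v}) e)"

text \<open>Counting starts from \<open>i = 1\<close>, the largest eigenvalue.\<close>

definition nth_largest_eigenvalue :: "nat \<Rightarrow> real^'n^'n \<Rightarrow> real" where
  "nth_largest_eigenvalue i A = rev (sorted_list_of_multiset (eigenvalue_mset A)) ! (i - 1)"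

text \<open>A system is a sequence of maps \<open>T 1\<close>, \<open>T 2\<close>, \dots; the entry \<open>T 0\<close> is never used.
  \<open>rds_iterate T t\<close> is \<open>T t \<circ> \<dots> \<circ> T 1\<close>.\<close>

primrec rds_iterate :: "(nat \<Rightarrow> 'a \<Rightarrow> 'a) \<Rightarrow> nat \<Rightarrow> 'a \<Rightarrow> 'a" where
  "rds_iterate T 0 = id"
| "rds_iterate T (Suc t) = T (Suc t) \<circ> rds_iterate T t"

definition rds_jacobian ::
    "(nat \<Rightarrow> real^'n \<Rightarrow> real^'n) \<Rightarrow> real^'n \<Rightarrow> nat \<Rightarrow> real^'n^'n" where
  "rds_jacobian T x0 t = jacobian (rds_iterate T t) (at x0)"

definition lyapunov_seq ::
    "(nat \<Rightarrow> real^'n \<Rightarrow> real^'n) \<Rightarrow> real^'n \<Rightarrow> nat \<Rightarrow> real^'n^'n" where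
  "lyapunov_seq T x0 t = psd_root t (rds_jacobian T x0 t ** transpose (rds_jacobian T x0 t))"

text \<open>Meaningful only if \<open>lyapunov_seq T x0\<close> is convergent.\<close>

definition lyapunov_matrix ::
    "(nat \<Rightarrow> real^'n \<Rightarrow> real^'n) \<Rightarrow> real^'n \<Rightarrow> real^'n^'n" where
  "lyapunov_matrix T x0 = lim (lyapunov_seq T x0)"

text \<open>Eigenvalues of the limit matrix are nonnegative; \<open>log\<^sub>2 0\<close> is read as \<open>-\<infinity>\<close>,
  since the value of \<^term>\<open>log 2 (0::real)\<close> is \<open>0\<close>.\<close>

definition lyapunov_exponent ::
    "nat \<Rightarrow> (nat \<Rightarrow> real^'n \<Rightarrow> real^'n) \<Rightarrow> real^'n \<Rightarrow> ereal" where
  "lyapunov_exponent i T x0 =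
     (let \<Lambda> = nth_largest_eigenvalue i (lyapunov_matrix T x0)
      in if \<Lambda> > 0 then ereal (log 2 \<Lambda>) else - \<infinity>)"

definition dnn_map ::
    "(real \<Rightarrow> real) \<Rightarrow> (nat \<Rightarrow> real^'n^'n) \<Rightarrow> (nat \<Rightarrow> real^'n) \<Rightarrow> nat \<Rightarrow> real^'n \<Rightarrow> real^'n" where
  "dnn_map \<phi> W b t x = (\<chi> i. \<phi> ((W t *v x + b t) $ i))"

end

theory Submission
  imports Defs
begin

text \<open>Take \<open>W t = a I\<close>, \<open>b t = 0\<close> and \<open>x0 = 0\<close>. The origin is a fixed point at which \<open>tanh\<close> has
  slope \<open>1\<close>, so the Jacobian after \<open>t\<close> steps is \<open>a\<^bsup>t\<^esup> I\<close> and the Lyapunov matrix is \<open>a\<^sup>2 I\<close>, with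
  maximum exponent \<open>2 log\<^sub>2 a\<close>. The root of \<open>a\<^bsup>2t\<^esup> I\<close> is identified without the spectral theorem:
  if \<open>B\<close> is positive semidefinite with \<open>B\<^bsup>t\<^esup> = c\<^bsup>t\<^esup> I\<close> and \<open>y = (B - c I) x\<close>, then
  \<open>(\<Sum>k<t. c\<^bsup>t-1-k\<^esup> B\<^bsup>k\<^esup>) y = 0\<close>, and the inner product of the left side with \<open>y\<close> is at least
  \<open>c\<^bsup>t-1\<^esup> \<parallel>y\<parallel>\<^sup>2\<close>.\<close>

lemma matpow_mult_vec: "matpow A k *v x = (((*v) A) ^^ k) x"
  by (induction k) (simp_all add: matpow_def flip: matrix_vector_mul_assoc)

lemma mat_mult_vec: "mat c *v (x :: real^'n) = c *\<^sub>R x"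
  by (simp add: vec_eq_iff matrix_vector_mult_def mat_def if_distrib if_distribR
      cong: if_cong)

lemma funpow_scaleR: "(((*\<^sub>R) c) ^^ k) (x :: 'a::real_vector) = c ^ k *\<^sub>R x"
  by (induction k) simp_all

lemma matpow_mat: "matpow (mat c :: real^'n^'n) k = mat (c ^ k)"
proof -
  have "((*v) (mat c :: real^'n^'n)) = (*\<^sub>R) c"
    by (rule ext) (rule mat_mult_vec)
  then show ?thesis
    by (simp add: matrix_eq matpow_mult_vec mat_mult_vec funpow_scaleR)
qed

text \<open>Symmetry moves one factor \<open>B\<close> across the inner product, so the form of
  \<open>B^(k+2)\<close> at \<open>x\<close> is the form of \<open>B^k\<close> at
  \<open>B *v x\<close>. Induction in steps of two therefore needs both base cases.\<close>

lemma psd_funpow_nonneg: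
  assumes "psd B"
  shows "0 \<le> x \<bullet> (((*v) B) ^^ k) x"
proof (induction k arbitrary: x rule: induct_nat_012)
  case 0
  show ?case by simp
next
  case 1
  show ?case using assms by (simp add: psd_def)
next
  case (ge2 k)
  have "x \<bullet> (((*v) B) ^^ Suc (Suc k)) x = x \<bullet> (B *v (((*v) B) ^^ k) (B *v x))"
    by (simp add: funpow_swap1)
  also have "\<dots> = (B *v x) \<bullet> (((*v) B) ^^ k) (B *v x)"
    using assms by (metis psd_def dot_lmul_matrix transpose_matrix_vector)
  finally show ?case using ge2(1) by simp
qed

text \<open>The factorization of \<open>f^t - c^t\<close> by \<open>f - c\<close>, valid because
  \<open>f\<close> commutes with scalars.\<close>

lemma funpow_minus_scaleR_telescope:
  fixes f :: "'a::real_vector \<Rightarrow> 'a"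
  assumes "linear f"
  shows "(\<Sum>k<t. c ^ (t - Suc k) *\<^sub>R (f ^^ k) (f x - c *\<^sub>R x)) = (f ^^ t) x - c ^ t *\<^sub>R x"
proof (induction t)
  case (Suc t)
  have lin: "linear (f ^^ k)" for k
    by (induction k) (simp_all only: funpow.simps linear_id linear_compose assms)
  \<comment> \<open>Passing to \<open>Suc t\<close> multiplies each old term by \<open>c\<close> and
    adds the term \<open>k = t\<close>.\<close>
  have "(\<Sum>k<t. c ^ (t - k) *\<^sub>R (f ^^ k) (f x - c *\<^sub>R x))
      = c *\<^sub>R (\<Sum>k<t. c ^ (t - Suc k) *\<^sub>R (f ^^ k) (f x - c *\<^sub>R x))"
    by (simp add: scaleR_sum_right flip: power_Suc Suc_diff_Suc)
  also have "\<dots> = c *\<^sub>R ((f ^^ t) x - c ^ t *\<^sub>R x)"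
    by (simp only: Suc)
  finally show ?case
    by (simp add: linear_diff[OF lin] linear_scale[OF lin] funpow_swap1 scaleR_diff_right)
qed simp

lemma psd_matpow_eq_mat_unique:
  fixes B :: "real^'n^'n"
  assumes "psd B" "matpow B t = mat (c ^ t)" "c > 0" "t > 0"
  shows "B = mat c"
proof -
  have "B *v x = c *\<^sub>R x" for x
  proof -
    define y where "y = B *v x - c *\<^sub>R x"
    have "(\<Sum>k<t. c ^ (t - Suc k) *\<^sub>R (((*v) B) ^^ k) y) = 0"
      using funpow_minus_scaleR_telescope[of "(*v) B" c t x] assms(2)
      by (simp add: y_def mat_mult_vec flip: matpow_mult_vec)
    then have "(\<Sum>k<t. c ^ (t - Suc k) * (y \<bullet> (((*v) B) ^^ k) y)) = 0"
      by (metis (no_types, lifting) inner_scaleR_right inner_sum_right inner_zero_right sum.cong)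
    moreover have "0 \<le> c ^ (t - Suc k) * (y \<bullet> (((*v) B) ^^ k) y)" for k
      using psd_funpow_nonneg[OF assms(1)] assms(3) by simp
    ultimately have "\<forall>k\<in>{..<t}. c ^ (t - Suc k) * (y \<bullet> (((*v) B) ^^ k) y) = 0"
      by (simp add: sum_nonneg_eq_0_iff)
    \<comment> \<open>Since \<open>t > 0\<close>, the index \<open>0\<close> is in range; its term
      is a positive multiple of \<open>y \<bullet> y\<close>.\<close>
    then have "c ^ (t - Suc 0) * (y \<bullet> (((*v) B) ^^ 0) y) = 0"
      using assms(4) by blast
    then have "y = 0" using assms(3) by simp
    then show ?thesis by (simp add: y_def)
  qed
  then show ?thesis by (simp add: matrix_eq mat_mult_vec)
qed

lemma psd_mat: "c \<ge> 0 \<Longrightarrow> psd (mat c :: real^'n^'n)"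
  by (simp add: psd_def transpose_mat mat_mult_vec)

lemma psd_root_mat:
  assumes "c > 0" "t > 0"
  shows "psd_root t (mat (c ^ t) :: real^'n^'n) = mat c"
  unfolding psd_root_def
proof (rule the_equality)
  show "psd (mat c) \<and> matpow (mat c :: real^'n^'n) t = mat (c ^ t)"
    using assms(1) by (simp add: psd_mat matpow_mat)
  show "B = mat c" if "psd B \<and> matpow B t = mat (c ^ t)" for B :: "real^'n^'n"
    using that assms by (blast intro: psd_matpow_eq_mat_unique)
qed

lemma nth_largest_eigenvalue_1_mat:
  "nth_largest_eigenvalue 1 (mat c :: real^'n^'n) = c"
proof -
  have "(axis undefined 1 :: real^'n) \<noteq> 0" by (simp add: axis_eq_0_iff)
  then have "eigenvalues (mat c :: real^'n^'n) = {c}"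
    unfolding eigenvalues_def mat_mult_vec scaleR_cancel_right by blast
  \<comment> \<open>The eigenspace is the whole space. Writing the multiset as \<open>mset\<close>
    of a list turns \<open>sorted_list_of_multiset\<close> into \<open>sort\<close>.\<close>
  then have "eigenvalue_mset (mat c :: real^'n^'n) = mset (replicate CARD('n) c)"
    by (simp add: eigenvalue_mset_def mat_mult_vec)
  moreover have "sort (replicate k c) = replicate k c" for k
    by (simp add: sorted_sort_id sorted_replicate)
  ultimately show ?thesis
    by (simp add: nth_largest_eigenvalue_def del: mset_replicate)
qed

lemma tanh_layer_has_derivative_0:
  "(dnn_map tanh (\<lambda>t. mat a) (\<lambda>t. 0) s has_derivative (*\<^sub>R) a) (at (0 :: real^'n))"
proof -
  have "((\<lambda>x. tanh (a * x $ i)) has_derivative (\<lambda>v. a * v $ i)) (at (0 :: real^'n))" for i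
  proof -
    have "((\<lambda>x. a * x $ i) has_derivative (\<lambda>v. a * v $ i)) (at (0 :: real^'n))"
      by (intro derivative_intros bounded_linear.has_derivative[OF bounded_linear_vec_nth])
    \<comment> \<open>The slope \<open>1 - tanh\<^sup>2\<close> equals \<open>1\<close> at the
      origin.\<close>
    moreover have "(tanh has_real_derivative 1) (at (a * (0 :: real^'n) $ i))"
      by (auto intro!: derivative_eq_intros)
    ultimately show ?thesis
      using diff_chain_at[where g = tanh and g' = "(*) 1"]
      by (fastforce simp: has_field_derivative_def o_def)
  qed
  then have "((\<lambda>x. \<chi> i. tanh (a * x $ i)) has_derivative (\<lambda>v. \<chi> i. a * v $ i)) (at (0 :: real^'n))"
    by (subst has_derivative_componentwise_within) (auto simp: Basis_vec_def inner_axis)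
  moreover have "dnn_map tanh (\<lambda>t. mat a) (\<lambda>t. 0) s = (\<lambda>x :: real^'n. \<chi> i. tanh (a * x $ i))"
    by (simp add: fun_eq_iff dnn_map_def mat_mult_vec)
  moreover have "(*\<^sub>R) a = (\<lambda>v :: real^'n. \<chi> i. a * v $ i)"
    by (simp add: fun_eq_iff vec_eq_iff)
  ultimately show ?thesis by simp
qed

lemma rds_jacobian_tanh_0:
  "rds_jacobian (dnn_map tanh (\<lambda>t. mat a) (\<lambda>t. 0)) (0 :: real^'n) t = mat (a ^ t)"
proof -
  let ?T = "dnn_map tanh (\<lambda>t. mat a) (\<lambda>t. 0) :: nat \<Rightarrow> real^'n \<Rightarrow> real^'n"
  \<comment> \<open>Every factor in the chain rule is thus a derivative at the origin.\<close>
  have fix0: "rds_iterate ?T t 0 = 0" for t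
    by (induction t) (simp_all add: dnn_map_def mat_mult_vec zero_vec_def)
  have "(rds_iterate ?T t has_derivative (*\<^sub>R) (a ^ t)) (at 0)"
  proof (induction t)
    case 0
    show ?case by (simp add: id_def)
  next
    case (Suc t)
    have "(?T (Suc t) has_derivative (*\<^sub>R) a) (at (rds_iterate ?T t 0))"
      by (simp add: fix0 tanh_layer_has_derivative_0)
    from diff_chain_at[OF Suc this] show ?case
      by (simp add: o_def)
  qed
  then have "frechet_derivative (rds_iterate ?T t) (at 0) = (*\<^sub>R) (a ^ t)"
    by (metis frechet_derivative_at)
  also have "\<dots> = (*v) (mat (a ^ t))"
    by (simp add: fun_eq_iff mat_mult_vec)
  finally show ?thesis
    by (simp add: rds_jacobian_def jacobian_def)
qed

lemma lyapunov_seq_tanh_0: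
  assumes "a > 0" "t > 0"
  shows "lyapunov_seq (dnn_map tanh (\<lambda>t. mat a) (\<lambda>t. 0)) (0 :: real^'n) t = mat (a\<^sup>2)"
proof -
  have "(mat (a ^ t) ** mat (a ^ t) :: real^'n^'n) = mat ((a\<^sup>2) ^ t)"
    by (simp add: matrix_eq mat_mult_vec power2_eq_square power_mult_distrib
        flip: matrix_vector_mul_assoc)
  then show ?thesis
    using assms by (simp add: lyapunov_seq_def rds_jacobian_tanh_0 transpose_mat psd_root_mat)
qed

theorem theorem2:
  fixes C :: real
  shows "\<exists>(W :: nat \<Rightarrow> real^'n^'n) (b :: nat \<Rightarrow> real^'n) (x0 :: real^'n).
           (\<forall>i. x0 $ i \<in> {-1..1}) \<and>
           convergent (lyapunov_seq (dnn_map tanh W b) x0) \<and>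
           lyapunov_exponent 1 (dnn_map tanh W b) x0 > ereal C"
proof -
  \<comment> \<open>This makes the exponent \<open>2 * (\<bar>C\<bar> + 1)\<close>, which exceeds
    \<open>C\<close> for either sign of \<open>C\<close>.\<close>
  define a :: real where "a = 2 powr (\<bar>C\<bar> + 1)"
  have a: "a > 0" by (simp add: a_def)
  let ?T = "dnn_map tanh (\<lambda>t. mat a) (\<lambda>t. 0) :: nat \<Rightarrow> real^'n \<Rightarrow> real^'n"
  \<comment> \<open>Only eventually: at \<open>t = 0\<close> every positive semidefinite matrix is a
    root, so \<open>THE\<close> gives no definite value.\<close>
  have "eventually (\<lambda>t. lyapunov_seq ?T 0 t = mat (a\<^sup>2)) sequentially"
    using eventually_gt_at_top[of 0] by eventually_elim (rule lyapunov_seq_tanh_0[OF a])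
  then have lim: "lyapunov_seq ?T 0 \<longlonglongrightarrow> mat (a\<^sup>2)"
    by (rule tendsto_eventually)
  then have "lyapunov_exponent 1 ?T 0 = ereal (log 2 (a\<^sup>2))"
    using a by (simp add: lyapunov_exponent_def lyapunov_matrix_def limI
        nth_largest_eigenvalue_1_mat[unfolded One_nat_def])
  also have "log 2 (a\<^sup>2) = 2 * (\<bar>C\<bar> + 1)"
    by (simp add: a_def log_nat_power)
  finally have "lyapunov_exponent 1 ?T 0 > ereal C"
    by simp
  moreover have "convergent (lyapunov_seq ?T 0)"
    using lim by (rule convergentI)
  moreover have "\<forall>i. (0 :: real^'n) $ i \<in> {-1..1}" by simp
  ultimately show ?thesis by blast
qed

end
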